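(* Consider the bases $[0321]$ (elements $A^{\downarrow\uparrow}_i,B^{\downarrow\uparrow}_i,\psi^{\downarrow\uparrow}_{i+1}$, $i\in\mathbb{N}$) and $[3012]$ (elements $A^{\uparrow\downarrow}_i,B^{\uparrow\downarrow}_i,\psi^{\uparrow\downarrow}_{i+1}$, $i\in\mathbb{N}$) of the Onsager Lie algebra $O$. The transition matrix from $[0321]$ to $[3012]$ is given by $$A^{\uparrow\downarrow}_i=-A^{\downarrow\uparrow}_i,\qquad B^{\uparrow\downarrow}_i=-B^{\downarrow\uparrow}_i,\qquad \psi^{\uparrow\downarrow}_{i+1}=-A^{\downarrow\uparrow}_i-B^{\downarrow\uparrow}_i+\psi^{\downarrow\uparrow}_{i+1}\qquad(i\in\mathbb{N}).$$ Moreover, the transition matrix from $[3012]$ to $[0321]$ is given by $$A^{\downarrow\uparrow}_i=-A^{\uparrow\downarrow}_i,\qquad B^{\downarrow\uparrow}_i=-B^{\uparrow\downarrow}_i,\qquad \psi^{\downarrow\uparrow}_{i+1}=-A^{\uparrow\downarrow}_i-B^{\uparrow\downarrow}_i+\psi^{\uparrow\downarrow}_{i+1}\qquad(i\in\mathbb{N}).$$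
   Context: $\mathbb{F}$ is a field of characteristic zero; $\mathbb{N}=\{0,1,2,\ldots\}$; tensor products are over $\mathbb{F}$. $\mathfrak{sl}_2$ is the Lie algebra over $\mathbb{F}$ with basis $e,f,h$ and $[h,e]=2e$, $[h,f]=-2f$, $[e,f]=h$; $x=2e-h$, $y=-2f-h$, $z=h$ is its equitable basis. $\mathcal{A}=\mathbb{F}[t,t^{-1},(t-1)^{-1}]$ with $t$ an indeterminate. $L(\mathfrak{sl}_2)^+=\mathfrak{sl}_2\otimes\mathcal{A}$ with Lie bracket $[u\otimes a,v\otimes b]=[u,v]\otimes ab$ and right $\mathcal{A}$-module structure $(u\otimes a)b=u\otimes ab$. The Onsager Lie algebra $O$ (generators $A,B$; relations $[A,[A,[A,B]]]=4[A,B]$, $[B,[B,[B,A]]]=4[B,A]$) is identified with the Lie subalgebra of $L(\mathfrak{sl}_2)^+$ generated by $A=x\otimes1$ and $B=y\otimes t+z\otimes(t-1)$. Bases of $O$ (indexed by $i\in\mathbb{N}$): $[0321]$: $A^{\downarrow\uparrow}_i=-x\otimes(-t)^i$, $B^{\downarrow\uparrow}_i=(y\otimes t+z\otimes(t-1))(-t)^i$, $\psi^{\downarrow\uparrow}_{i+1}=-y\otimes(-t)^{i+1}$. $[3012]$: $A^{\uparrow\downarrow}_i=x\otimes(-t)^i$, $B^{\uparrow\downarrow}_i=(-y\otimes t-z\otimes(t-1))(-t)^i$, $\psi^{\uparrow\downarrow}_{i+1}=(x\otimes1-z\otimes(t-1))(-t)^i$. The transition matrix from one basis to another is described by expressing each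 element of the second basis as a linear combination of the elements of the first. *)

theory Defs
  imports "HOL.Hull" "HOL-Computational_Algebra.Polynomial" "HOL-Computational_Algebra.Fraction_Field"
begin

section \<open>The algebra \<open>F[t, t\<^sup>-\<^sup>1, (t - 1)\<^sup>-\<^sup>1]\<close>\<close>

typedef (overloaded) ('a :: field) loc =
  "{Fract p ([:0, 1:] ^ m * [:-1, 1:] ^ n) | (p :: 'a poly) m n. True}"
  by blast

setup_lifting type_definition_loc

text \<open>Keeps \<open>transfer\<close> from unfolding polynomials into coefficient functions.\<close>

lifting_forget poly.lifting

lemma loc_denom_nonzero: "[:0, 1:] ^ m * [:-1, 1:] ^ n \<noteq> (0 :: 'a :: field poly)"
  by simp

instantiation loc :: (field) comm_ring_1
begin

lift_definition zero_loc :: "'a loc" is 0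
proof -
  have "(0 :: 'a poly fract) = Fract 0 ([:0, 1:] ^ 0 * [:-1, 1:] ^ 0)"
    by (simp add: Zero_fract_def)
  then show "\<exists>p m n. (0 :: 'a poly fract) = Fract p ([:0, 1:] ^ m * [:-1, 1:] ^ n) \<and> True"
    by blast
qed

lift_definition one_loc :: "'a loc" is 1
proof -
  have "(1 :: 'a poly fract) = Fract 1 ([:0, 1:] ^ 0 * [:-1, 1:] ^ 0)"
    by (simp add: One_fract_def)
  then show "\<exists>p m n. (1 :: 'a poly fract) = Fract p ([:0, 1:] ^ m * [:-1, 1:] ^ n) \<and> True"
    by blast
qed

lift_definition uminus_loc :: "'a loc \<Rightarrow> 'a loc" is uminus
  by (metis minus_fract)

lift_definition times_loc :: "'a loc \<Rightarrow> 'a loc \<Rightarrow> 'a loc" is "(*)"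
proof -
  fix r s :: "'a poly fract"
  assume "\<exists>p m n. r = Fract p ([:0, 1:] ^ m * [:-1, 1:] ^ n) \<and> True"
    and "\<exists>p m n. s = Fract p ([:0, 1:] ^ m * [:-1, 1:] ^ n) \<and> True"
  then obtain p m n q k l where "r = Fract p ([:0, 1:] ^ m * [:-1, 1:] ^ n)"
    and "s = Fract q ([:0, 1:] ^ k * [:-1, 1:] ^ l)"
    by blast
  then have "r * s = Fract (p * q) ([:0, 1:] ^ (m + k) * [:-1, 1:] ^ (n + l))"
    by (simp only: mult_fract power_add mult_ac)
  then show "\<exists>p m n. r * s = Fract p ([:0, 1:] ^ m * [:-1, 1:] ^ n) \<and> True"
    by blast
qed

lift_definition plus_loc :: "'a loc \<Rightarrow> 'a loc \<Rightarrow> 'a loc" is "(+)"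
proof -
  fix r s :: "'a poly fract"
  assume "\<exists>p m n. r = Fract p ([:0, 1:] ^ m * [:-1, 1:] ^ n) \<and> True"
    and "\<exists>p m n. s = Fract p ([:0, 1:] ^ m * [:-1, 1:] ^ n) \<and> True"
  then obtain p m n q k l where "r = Fract p ([:0, 1:] ^ m * [:-1, 1:] ^ n)"
    and "s = Fract q ([:0, 1:] ^ k * [:-1, 1:] ^ l)"
    by blast
  then have "r + s = Fract (p * ([:0, 1:] ^ k * [:-1, 1:] ^ l) + q * ([:0, 1:] ^ m * [:-1, 1:] ^ n))
      ([:0, 1:] ^ (m + k) * [:-1, 1:] ^ (n + l))"
    by (simp only: add_fract[OF loc_denom_nonzero loc_denom_nonzero] power_add mult_ac)
  then show "\<exists>p m n. r + s = Fract p ([:0, 1:] ^ m * [:-1, 1:] ^ n) \<and> True"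
    by blast
qed

definition minus_loc :: "'a loc \<Rightarrow> 'a loc \<Rightarrow> 'a loc"
  where "minus_loc a b = a + - b"

instance
proof
  fix a b c :: "'a loc"
  show "a * b * c = a * (b * c)" "a * b = b * a" "1 * a = a"
    "a + b + c = a + (b + c)" "a + b = b + a" "0 + a = a" "- a + a = 0"
    "(a + b) * c = a * c + b * c" "(0 :: 'a loc) \<noteq> 1"
    by (transfer, simp add: algebra_simps)+
  show "a - b = a + - b"
    by (rule minus_loc_def)
qed

end

lift_definition loc_of_poly :: "'a :: field poly \<Rightarrow> 'a loc" is "\<lambda>p. Fract p 1"
proof -
  fix p :: "'a poly"
  have "Fract p 1 = Fract p ([:0, 1:] ^ 0 * [:-1, 1:] ^ 0)"
    by simp
  then show "\<exists>q m n. Fract p 1 = Fract q ([:0, 1:] ^ m * [:-1, 1:] ^ n) \<and> True"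
    by blast
qed

definition loc_const :: "'a :: field \<Rightarrow> 'a loc"
  where "loc_const c = loc_of_poly [:c:]"

definition loc_t :: "'a :: field loc"
  where "loc_t = loc_of_poly [:0, 1:]"

lemma loc_of_poly_hom:
  "loc_of_poly (p + q) = loc_of_poly p + loc_of_poly q"
  "loc_of_poly (p * q) = loc_of_poly p * loc_of_poly q"
  "loc_of_poly 0 = 0"
  "loc_of_poly 1 = 1"
  by (transfer, simp add: Zero_fract_def One_fract_def)+

lemma loc_of_poly_inj: "inj loc_of_poly"
  by (rule injI, transfer) (simp add: eq_fract)

lemma loc_const_hom:
  "loc_const (a + b) = loc_const a + loc_const b"
  "loc_const (a * b) = loc_const a * loc_const b"
  "loc_const 0 = 0"
  "loc_const 1 = 1"
proof -
  show "loc_const (a + b) = loc_const a + loc_const b"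
    by (simp add: loc_const_def flip: loc_of_poly_hom)
  show "loc_const (a * b) = loc_const a * loc_const b"
    unfolding loc_const_def loc_of_poly_hom(2)[symmetric] by (simp add: mult.commute)
  show "loc_const 0 = 0"
    by (simp add: loc_const_def loc_of_poly_hom)
  show "loc_const 1 = 1"
    by (simp add: loc_const_def loc_of_poly_hom flip: one_pCons)
qed

lemma loc_of_poly_dvd_1:
  fixes d :: "'a :: field poly"
  assumes "d = [:0, 1:] ^ m * [:-1, 1:] ^ n"
  shows "loc_of_poly d dvd 1"
proof -
  have "Fract 1 d \<in> {Fract p ([:0, 1:] ^ m * [:-1, 1:] ^ n) | (p :: 'a poly) m n. True}"
    using assms by blast
  then have "Rep_loc (loc_of_poly d * Abs_loc (Fract 1 d)) = Fract d 1 * Fract 1 d"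
    by (simp only: times_loc.rep_eq loc_of_poly.rep_eq Abs_loc_inverse)
  also have "\<dots> = Rep_loc 1"
    using assms loc_denom_nonzero[of m n] by (simp add: one_loc.rep_eq One_fract_def eq_fract)
  finally have "1 = loc_of_poly d * Abs_loc (Fract 1 d)"
    by (simp only: Rep_loc_inject)
  then show ?thesis
    by (rule dvdI)
qed

lemma loc_t_dvd_1: "loc_t dvd 1"
  unfolding loc_t_def by (rule loc_of_poly_dvd_1[where m = 1 and n = 0]) simp

lemma loc_t_minus_1_dvd_1: "(loc_t - 1 :: 'a :: field loc) dvd 1"
proof -
  have "loc_of_poly [:-1, 1 :: 'a:] + loc_of_poly 1 = loc_of_poly [:0, 1:]"
    by (simp add: one_pCons flip: loc_of_poly_hom(1))
  then have "loc_t - 1 = loc_of_poly [:-1, 1 :: 'a:]"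
    by (simp add: loc_t_def loc_of_poly_hom(4) algebra_simps)
  then show ?thesis
    using loc_of_poly_dvd_1[where m = 0 and n = 1] by simp
qed


section \<open>\<open>sl\<^sub>2\<close> and \<open>L(sl\<^sub>2)\<^sup>+\<close>\<close>

text \<open>
  \<open>Sl2 a b c\<close> is the element with coordinates \<open>a, b, c\<close> in the basis \<open>e, f, h\<close>. The coordinates
  range over an arbitrary commutative ring: \<open>'a sl2\<close> is \<open>sl\<^sub>2\<close> over the field \<open>'a\<close>, and
  \<open>'a loc sl2\<close>, the free module on \<open>e, f, h\<close> over the algebra above, is the tensor product of
  \<open>'a sl2\<close> with that algebra (see \<open>tensor_universal\<close>).
\<close>

datatype 'c sl2 = Sl2 (coeff_e: 'c) (coeff_f: 'c) (coeff_h: 'c)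

instantiation sl2 :: (ab_group_add) ab_group_add
begin

definition zero_sl2 :: "'a sl2"
  where "0 = Sl2 0 0 0"

definition plus_sl2 :: "'a sl2 \<Rightarrow> 'a sl2 \<Rightarrow> 'a sl2"
  where "u + v = Sl2 (coeff_e u + coeff_e v) (coeff_f u + coeff_f v) (coeff_h u + coeff_h v)"

definition minus_sl2 :: "'a sl2 \<Rightarrow> 'a sl2 \<Rightarrow> 'a sl2"
  where "u - v = Sl2 (coeff_e u - coeff_e v) (coeff_f u - coeff_f v) (coeff_h u - coeff_h v)"

definition uminus_sl2 :: "'a sl2 \<Rightarrow> 'a sl2"
  where "- u = Sl2 (- coeff_e u) (- coeff_f u) (- coeff_h u)"

instance
  by standard (simp_all add: zero_sl2_def plus_sl2_def minus_sl2_def uminus_sl2_def add_ac)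

end

definition mul_right :: "'c :: comm_ring_1 sl2 \<Rightarrow> 'c \<Rightarrow> 'c sl2"  (infixl \<open>\<bullet>\<close> 70)
  where "u \<bullet> b = Sl2 (coeff_e u * b) (coeff_f u * b) (coeff_h u * b)"

text \<open>The bilinear extension of \<open>[h, e] = 2 e\<close>, \<open>[h, f] = - 2 f\<close>, \<open>[e, f] = h\<close>.\<close>

definition lie :: "'c :: comm_ring_1 sl2 \<Rightarrow> 'c sl2 \<Rightarrow> 'c sl2"
  where "lie u v = Sl2
    (2 * (coeff_h u * coeff_e v - coeff_e u * coeff_h v))
    (- 2 * (coeff_h u * coeff_f v - coeff_f u * coeff_h v))
    (coeff_e u * coeff_f v - coeff_f u * coeff_e v)"

definition sl2_e :: "'a :: field sl2" where "sl2_e = Sl2 1 0 0"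
definition sl2_f :: "'a :: field sl2" where "sl2_f = Sl2 0 1 0"
definition sl2_h :: "'a :: field sl2" where "sl2_h = Sl2 0 0 1"

definition sl2_x :: "'a :: field sl2" where "sl2_x = sl2_e \<bullet> 2 - sl2_h"
definition sl2_y :: "'a :: field sl2" where "sl2_y = - (sl2_f \<bullet> 2) - sl2_h"
definition sl2_z :: "'a :: field sl2" where "sl2_z = sl2_h"

definition tensor :: "'a :: field sl2 \<Rightarrow> 'a loc \<Rightarrow> 'a loc sl2"  (infixl \<open>\<otimes>\<close> 75)
  where "u \<otimes> a = map_sl2 loc_const u \<bullet> a"

definition scale_sl2 :: "'a :: field \<Rightarrow> 'a sl2 \<Rightarrow> 'a sl2"
  where "scale_sl2 c u = u \<bullet> c"

definition scale_loc :: "'a :: field \<Rightarrow> 'a loc \<Rightarrow> 'a loc"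
  where "scale_loc c a = loc_const c * a"

definition scale_L :: "'a :: field \<Rightarrow> 'a loc sl2 \<Rightarrow> 'a loc sl2"
  where "scale_L c u = u \<bullet> loc_const c"

lemmas sl2_arith_defs = zero_sl2_def plus_sl2_def minus_sl2_def uminus_sl2_def mul_right_def lie_def

lemmas sl2_basis_defs = sl2_x_def sl2_y_def sl2_z_def sl2_e_def sl2_f_def sl2_h_def

lemma lie_efh:
  "lie sl2_h sl2_e = scale_sl2 2 sl2_e"
  "lie sl2_h sl2_f = scale_sl2 (- 2) sl2_f"
  "lie sl2_e sl2_f = sl2_h"
  by (simp_all add: sl2_basis_defs sl2_arith_defs scale_sl2_def)

lemma lie_alternating: "lie u u = 0"
  by (simp add: sl2_arith_defs algebra_simps)

lemma lie_bilinear: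
  "lie (u + v) w = lie u w + lie v w"
  "lie w (u + v) = lie w u + lie w v"
  "lie (u \<bullet> a) w = lie u w \<bullet> a"
  "lie w (u \<bullet> a) = lie w u \<bullet> a"
  by (simp_all add: sl2_arith_defs algebra_simps)

lemma lie_jacobi: "lie u (lie v w) + lie v (lie w u) + lie w (lie u v) = 0"
  by (simp add: sl2_arith_defs algebra_simps)

interpretation sl2_vs: vector_space scale_sl2
  by standard (simp_all add: scale_sl2_def sl2_arith_defs algebra_simps)

interpretation loc_vs: vector_space scale_loc
  by standard (simp_all add: scale_loc_def loc_const_hom algebra_simps)

interpretation L_vs: vector_space scale_L
  by standard (simp_all add: scale_L_def sl2_arith_defs loc_const_hom algebra_simps)

lemma loc_const_diff: "loc_const (a - b) = loc_const a - loc_const b"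
  by (metis add_diff_cancel_right' diff_add_cancel loc_const_hom(1))

lemma loc_const_uminus: "loc_const (- a) = - loc_const a"
  by (metis diff_0 loc_const_diff loc_const_hom(3))

lemma loc_const_2: "loc_const 2 = 2"
  by (metis loc_const_hom(1,4) one_add_one)

lemma lie_tensor: "lie (u \<otimes> a) (v \<otimes> b) = lie u v \<otimes> (a * b)"
  by (simp add: tensor_def sl2_arith_defs sl2.map_sel loc_const_hom loc_const_diff loc_const_uminus
      loc_const_2 algebra_simps)

lemma tensor_mul_right: "(u \<otimes> a) \<bullet> b = u \<otimes> (a * b)"
  by (simp add: tensor_def sl2_arith_defs algebra_simps)

lemma tensor_add_left: "(u + v) \<otimes> a = u \<otimes> a + v \<otimes> a"
  and tensor_add_right: "u \<otimes> (a + b) = u \<otimes> a + u \<otimes> b"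
  and tensor_scale_left: "scale_sl2 c u \<otimes> a = scale_L c (u \<otimes> a)"
  and tensor_scale_right: "u \<otimes> scale_loc c a = scale_L c (u \<otimes> a)"
  by (simp_all add: tensor_def sl2_arith_defs sl2.map_sel scale_sl2_def scale_L_def scale_loc_def
      loc_const_hom algebra_simps)

lemma tensor_expand:
  "w = sl2_e \<otimes> coeff_e w + sl2_f \<otimes> coeff_f w + sl2_h \<otimes> coeff_h w"
  by (simp add: tensor_def sl2_basis_defs sl2_arith_defs loc_const_hom)

lemma sl2_expand:
  "u = scale_sl2 (coeff_e u) sl2_e + scale_sl2 (coeff_f u) sl2_f + scale_sl2 (coeff_h u) sl2_h"
  by (simp add: scale_sl2_def sl2_basis_defs sl2_arith_defs)

lemma tensor_universal:
  fixes \<beta> :: "'a :: field sl2 \<Rightarrow> 'a loc \<Rightarrow> 'v :: ab_group_add"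
  assumes "\<And>a. Vector_Spaces.linear scale_sl2 s (\<lambda>u. \<beta> u a)" and "\<And>u. Vector_Spaces.linear scale_loc s (\<beta> u)"
  shows "\<exists>!g. Vector_Spaces.linear scale_L s g \<and> (\<forall>u a. g (u \<otimes> a) = \<beta> u a)"
proof
  interpret l: Vector_Spaces.linear scale_sl2 s "\<lambda>u. \<beta> u a" for a by (rule assms)
  interpret r: Vector_Spaces.linear scale_loc s "\<beta> u" for u by (rule assms)
  define g where "g w = \<beta> sl2_e (coeff_e w) + \<beta> sl2_f (coeff_f w) + \<beta> sl2_h (coeff_h w)" for w
  have c: "coeff_e (scale_L k w) = scale_loc k (coeff_e w)"
    "coeff_f (scale_L k w) = scale_loc k (coeff_f w)"
    "coeff_h (scale_L k w) = scale_loc k (coeff_h w)" for k and w :: "'a loc sl2"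
    by (simp_all add: scale_L_def scale_loc_def mul_right_def mult.commute)
  have "Vector_Spaces.linear scale_L s g"
    by unfold_locales (simp_all add: g_def plus_sl2_def r.add c r.scale l.vs2.scale_right_distrib)
  moreover have "g (u \<otimes> a) = \<beta> u a" for u a
  proof -
    have t: "coeff_e (u \<otimes> a) = scale_loc (coeff_e u) a" "coeff_f (u \<otimes> a) = scale_loc (coeff_f u) a"
      "coeff_h (u \<otimes> a) = scale_loc (coeff_h u) a"
      by (simp_all add: tensor_def mul_right_def scale_loc_def sl2.map_sel)
    have "\<beta> u a = \<beta> (scale_sl2 (coeff_e u) sl2_e + scale_sl2 (coeff_f u) sl2_f
        + scale_sl2 (coeff_h u) sl2_h) a"
      using sl2_expand[of u] by simp
    then show ?thesis
      by (simp add: g_def t l.add l.scale r.scale)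
  qed
  ultimately show "Vector_Spaces.linear scale_L s g \<and> (\<forall>u a. g (u \<otimes> a) = \<beta> u a)"
    by blast
  fix g' assume g': "Vector_Spaces.linear scale_L s g' \<and> (\<forall>u a. g' (u \<otimes> a) = \<beta> u a)"
  then interpret g': Vector_Spaces.linear scale_L s g' by blast
  show "g' = g"
  proof
    fix w
    have "g' w = g' (sl2_e \<otimes> coeff_e w + sl2_f \<otimes> coeff_f w + sl2_h \<otimes> coeff_h w)"
      using tensor_expand[of w] by simp
    then show "g' w = g w"
      using g' by (simp add: g'.add g_def)
  qed
qed


section \<open>The Onsager Lie algebra\<close>

definition lie_subalgebra :: "'a :: field loc sl2 set \<Rightarrow> bool"
  where "lie_subalgebra S \<longleftrightarrow> L_vs.subspace S \<and> (\<forall>u \<in> S. \<forall>v \<in> S. lie u v \<in> S)"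

definition onsager_A :: "'a :: field loc sl2"
  where "onsager_A = sl2_x \<otimes> 1"

definition onsager_B :: "'a :: field loc sl2"
  where "onsager_B = sl2_y \<otimes> loc_t + sl2_z \<otimes> (loc_t - 1)"

definition onsager :: "'a :: field loc sl2 set"
  where "onsager = lie_subalgebra hull {onsager_A, onsager_B}"

lemma onsager_relations:
  "lie onsager_A (lie onsager_A (lie onsager_A onsager_B)) = scale_L 4 (lie onsager_A onsager_B)"
  "lie onsager_B (lie onsager_B (lie onsager_B onsager_A)) = scale_L 4 (lie onsager_B onsager_A)"
proof -
  have 4: "loc_const 4 = 4"
    using loc_const_hom(1)[of 2 2] by (simp add: loc_const_2)
  have A: "onsager_A = Sl2 2 0 (- 1)"
    by (simp add: onsager_A_def tensor_def sl2_basis_defs sl2_arith_defs loc_const_hom loc_const_2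
        loc_const_uminus)
  have B: "onsager_B = Sl2 0 (- 2 * loc_t) (- 1)"
    by (simp add: onsager_B_def tensor_def sl2_basis_defs sl2_arith_defs loc_const_hom loc_const_2
        loc_const_uminus)
  show "lie onsager_A (lie onsager_A (lie onsager_A onsager_B)) = scale_L 4 (lie onsager_A onsager_B)"
    "lie onsager_B (lie onsager_B (lie onsager_B onsager_A)) = scale_L 4 (lie onsager_B onsager_A)"
    by (simp_all add: A B lie_def scale_L_def mul_right_def 4)
qed


section \<open>The bases \<open>[0321]\<close> and \<open>[3012]\<close>\<close>

text \<open>
  The suffixes \<open>_du\<close> and \<open>_ud\<close> stand for the superscripts \<open>\<down>\<up>\<close> and \<open>\<up>\<down>\<close>. The elements \<open>\<psi>\<close> are
  indexed from \<open>1\<close>; the functions below are unspecified at \<open>0\<close>.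
\<close>

definition A_du :: "nat \<Rightarrow> 'a :: field loc sl2"
  where "A_du i = - (sl2_x \<otimes> (- loc_t) ^ i)"

definition B_du :: "nat \<Rightarrow> 'a :: field loc sl2"
  where "B_du i = (sl2_y \<otimes> loc_t + sl2_z \<otimes> (loc_t - 1)) \<bullet> (- loc_t) ^ i"

fun psi_du :: "nat \<Rightarrow> 'a :: field loc sl2"
  where "psi_du (Suc i) = - (sl2_y \<otimes> (- loc_t) ^ (i + 1))"

definition A_ud :: "nat \<Rightarrow> 'a :: field loc sl2"
  where "A_ud i = sl2_x \<otimes> (- loc_t) ^ i"

definition B_ud :: "nat \<Rightarrow> 'a :: field loc sl2"
  where "B_ud i = (- (sl2_y \<otimes> loc_t) - sl2_z \<otimes> (loc_t - 1)) \<bullet> (- loc_t) ^ i"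

fun psi_ud :: "nat \<Rightarrow> 'a :: field loc sl2"
  where "psi_ud (Suc i) = (sl2_x \<otimes> 1 - sl2_z \<otimes> (loc_t - 1)) \<bullet> (- loc_t) ^ i"

datatype basis_index = A_index nat | B_index nat | psi_Suc_index nat

fun basis_0321 :: "basis_index \<Rightarrow> 'a :: field loc sl2"
  where
    "basis_0321 (A_index i) = A_du i"
  | "basis_0321 (B_index i) = B_du i"
  | "basis_0321 (psi_Suc_index i) = psi_du (i + 1)"

fun basis_3012 :: "basis_index \<Rightarrow> 'a :: field loc sl2"
  where
    "basis_3012 (A_index i) = A_ud i"
  | "basis_3012 (B_index i) = B_ud i"
  | "basis_3012 (psi_Suc_index i) = psi_ud (i + 1)"

definition is_basis_of :: "('i \<Rightarrow> 'a :: field loc sl2) \<Rightarrow> 'a loc sl2 set \<Rightarrow> bool"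
  where "is_basis_of b V \<longleftrightarrow> inj b \<and> L_vs.independent (range b) \<and> L_vs.span (range b) = V"

end

theory Submission
  imports Defs
begin

text \<open>
  Each of the two families consists of the multiples \<open>u (-t)\<^sup>i\<close>, \<open>v (-t)\<^sup>i\<close>, \<open>w (-t)\<^sup>i\<close> of three
  elements that are linearly independent over \<open>F[t]\<close>. Hence it is a basis of the \<open>F[t]\<close>-module
  generated by these elements, and the transition formulas show that both modules are the same.
  With \<open>Y = y \<otimes> t\<close>, the identities
  \<open>[A, B] = 2 A - 2 B + 4 Y\<close>, \<open>[A, Y] = 2 t A + 2 Y\<close> and \<open>[B, Y] = 2 Y - 2 t B\<close>
  show that this module is closed under the bracket; applied to the multiples by powers of \<open>t\<close> they
  also produce, by induction, every basis element from \<open>A\<close> and \<open>B\<close>.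
\<close>

section \<open>Polynomials inside the coefficient algebra, and independence of indexed
  families\<close>

interpretation sl2_mod: module "\<lambda>b u. u \<bullet> b"
  by standard (simp_all add: sl2_arith_defs algebra_simps)

lemma loc_of_poly_uminus: "loc_of_poly (- p) = - loc_of_poly p"
  by (metis add_eq_0_iff loc_of_poly_hom(1,3) right_minus)

lemma loc_of_poly_diff: "loc_of_poly (p - q) = loc_of_poly p - loc_of_poly q"
  by (metis add_diff_cancel diff_add_cancel loc_of_poly_hom(1))

lemma loc_of_poly_power: "loc_of_poly (p ^ n) = loc_of_poly p ^ n"
  by (induction n) (simp_all add: loc_of_poly_hom)

lemma loc_of_poly_numeral: "loc_of_poly (numeral n) = numeral n"
proof -
  have "loc_of_poly (of_nat k) = of_nat k" for k
    by (induction k) (simp_all add: loc_of_poly_hom)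
  from this[of "numeral n"] show ?thesis
    by simp
qed

lemma loc_of_poly_smult: "loc_of_poly (smult c p) = loc_const c * loc_of_poly p"
  by (simp add: loc_const_def flip: loc_of_poly_hom(2))

lemma loc_of_poly_pCons: "loc_of_poly (pCons c p) = loc_const c + loc_t * loc_of_poly p"
  by (simp add: loc_const_def loc_t_def flip: loc_of_poly_hom)

lemmas loc_of_poly_simps = loc_of_poly_hom loc_of_poly_uminus loc_of_poly_diff loc_of_poly_power
  loc_of_poly_numeral

lemma loc_of_poly_eq_0_iff: "loc_of_poly p = 0 \<longleftrightarrow> p = 0"
  by (metis injD loc_of_poly_hom(3) loc_of_poly_inj)

text \<open>A relation over indices also detects repetitions, which independence of the range
  cannot. Once \<open>b\<close> is injective, a relation on a subset of the range pulls back to the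
  indices.\<close>

lemma independent_family:
  fixes b :: "'i \<Rightarrow> 'a :: field loc sl2"
  assumes b: "\<And>I c i. finite I \<Longrightarrow> (\<Sum>i\<in>I. scale_L (c i) (b i)) = 0 \<Longrightarrow> i \<in> I \<Longrightarrow> c i = 0"
  shows "inj b" and "L_vs.independent (range b)"
proof -
  show inj: "inj b"
  proof (rule injI, rule ccontr)
    fix i j assume ij: "b i = b j" "i \<noteq> j"
    \<comment> \<open>A repeated value yields the relation \<open>b i - b j = 0\<close> with nonzero
      coefficients.\<close>
    have "(\<Sum>k\<in>{i, j}. scale_L (if k = i then 1 else - 1) (b k)) = 0"
      using ij by simp
    from b[OF _ this, of i] show False
      by simp
  qed
  show "L_vs.independent (range b)"
    unfolding L_vs.dependent_explicit
  proof clarify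
    fix T c v assume T: "finite T" "T \<subseteq> range b" "(\<Sum>v\<in>T. scale_L (c v) v) = 0" "v \<in> T" "c v \<noteq> 0"
    then obtain I where I: "finite I" "T = b ` I"
      by (meson finite_subset_image)
    from T(3) have "(\<Sum>i\<in>I. scale_L (c (b i)) (b i)) = 0"
      unfolding I using inj by (simp add: sum.reindex inj_on_subset)
    from b[OF I(1) this] T(4,5) I(2) show False
      by blast
  qed
qed

section \<open>Free \<open>F[t]\<close>-modules of rank three\<close>

text \<open>The common shape of both bases. Signs are kept in the powers of \<open>- loc_t\<close>
  so that the bases are instances without rescaling.\<close>

fun t_family :: "'a :: field loc sl2 \<Rightarrow> 'a loc sl2 \<Rightarrow> 'a loc sl2 \<Rightarrow> basis_index \<Rightarrow> 'a loc sl2"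
  where
    "t_family u v w (A_index i) = u \<bullet> (- loc_t) ^ i"
  | "t_family u v w (B_index i) = v \<bullet> (- loc_t) ^ i"
  | "t_family u v w (psi_Suc_index i) = w \<bullet> (- loc_t) ^ i"

text \<open>The general element of the F[t]-module generated by \<open>u\<close>, \<open>v\<close>,
  \<open>w\<close>. Coefficients are kept as polynomials, so that degrees and the absence of zero
  divisors are at hand.\<close>

definition poly_comb :: "'a :: field loc sl2 \<Rightarrow> 'a loc sl2 \<Rightarrow> 'a loc sl2 \<Rightarrow>
    'a poly \<Rightarrow> 'a poly \<Rightarrow> 'a poly \<Rightarrow> 'a loc sl2"
  where "poly_comb u v w p q r = u \<bullet> loc_of_poly p + v \<bullet> loc_of_poly q + w \<bullet> loc_of_poly r"

lemma poly_comb_add: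
  "poly_comb u v w p q r + poly_comb u v w p' q' r' = poly_comb u v w (p + p') (q + q') (r + r')"
  by (simp add: poly_comb_def loc_of_poly_hom sl2_mod.scale_left_distrib)

lemma poly_comb_0: "poly_comb u v w 0 0 0 = 0"
  by (simp add: poly_comb_def loc_of_poly_hom)

lemma poly_comb_scale:
  "scale_L c (poly_comb u v w p q r) = poly_comb u v w (smult c p) (smult c q) (smult c r)"
  by (simp add: poly_comb_def loc_of_poly_smult scale_L_def sl2_mod.scale_right_distrib mult_ac)

lemma poly_comb_sum:
  "(\<Sum>i\<in>I. poly_comb u v w (p i) (q i) (r i)) = poly_comb u v w (sum p I) (sum q I) (sum r I)"
  by (induction I rule: infinite_finite_induct) (simp_all add: poly_comb_0 poly_comb_add)

text \<open>\<open>S\<close> need not be closed under multiplication by t, so all powers are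
  assumed. The induction passes from \<open>u\<close> to its multiple by -t, whose powers are again
  in \<open>S\<close>.\<close>

lemma mul_poly_in_subspace:
  assumes "L_vs.subspace S" and "\<And>i. u \<bullet> (- loc_t) ^ i \<in> S"
  shows "u \<bullet> loc_of_poly p \<in> S"
  using assms(2)
proof (induction p arbitrary: u)
  case 0
  then show ?case
    using assms(1) by (simp add: loc_of_poly_hom L_vs.subspace_0)
next
  case (pCons c p)
  have "u \<bullet> (- loc_t) \<bullet> (- loc_t) ^ i \<in> S" for i
    using pCons.prems[of "Suc i"] by (simp add: mult_ac)
  then have "u \<bullet> (- loc_t) \<bullet> loc_of_poly p \<in> S"
    by (rule pCons.IH)
  then have "- (u \<bullet> (- loc_t) \<bullet> loc_of_poly p) \<in> S"
    using assms(1) by (rule L_vs.subspace_neg[rotated])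
  moreover have "scale_L c u \<in> S"
    using pCons.prems[of 0] assms(1) by (simp add: L_vs.subspace_scale)
  moreover have "u \<bullet> loc_of_poly (pCons c p) = scale_L c u + - (u \<bullet> (- loc_t) \<bullet> loc_of_poly p)"
    by (simp add: loc_of_poly_pCons scale_L_def sl2_mod.scale_left_distrib mult_ac)
  ultimately show ?case
    using assms(1) by (simp add: L_vs.subspace_add)
qed

lemma span_t_family:
  "L_vs.span (range (t_family u v w)) = {poly_comb u v w p q r | p q r. True}"
proof (rule L_vs.span_subspace)
  have "t_family u v w i \<in> {poly_comb u v w p q r | p q r. True}" for i
  proof (cases i)
    case (A_index n)
    then have "t_family u v w i = poly_comb u v w ((- [:0, 1:]) ^ n) 0 0"
      by (simp add: poly_comb_def loc_of_poly_simps loc_t_def del: minus_pCons)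
    then show ?thesis by blast
  next
    case (B_index n)
    then have "t_family u v w i = poly_comb u v w 0 ((- [:0, 1:]) ^ n) 0"
      by (simp add: poly_comb_def loc_of_poly_simps loc_t_def del: minus_pCons)
    then show ?thesis by blast
  next
    case (psi_Suc_index n)
    then have "t_family u v w i = poly_comb u v w 0 0 ((- [:0, 1:]) ^ n)"
      by (simp add: poly_comb_def loc_of_poly_simps loc_t_def del: minus_pCons)
    then show ?thesis by blast
  qed
  then show "range (t_family u v w) \<subseteq> {poly_comb u v w p q r | p q r. True}"
    by blast
  show "{poly_comb u v w p q r | p q r. True} \<subseteq> L_vs.span (range (t_family u v w))"
  proof -
    have "t_family u v w i \<in> L_vs.span (range (t_family u v w))" for i
      by (simp add: L_vs.span_base)
    from this[of "A_index _"] this[of "B_index _"] this[of "psi_Suc_index _"]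
    have "poly_comb u v w p q r \<in> L_vs.span (range (t_family u v w))" for p q r
      unfolding poly_comb_def
      by (intro L_vs.span_add mul_poly_in_subspace) simp_all
    then show ?thesis by blast
  qed
  show "L_vs.subspace {poly_comb u v w p q r | p q r. True}"
  proof (rule L_vs.subspaceI)
    show "0 \<in> {poly_comb u v w p q r | p q r. True}"
      by (metis (mono_tags, lifting) mem_Collect_eq poly_comb_0)
  qed (auto simp: poly_comb_add poly_comb_scale, blast+)
qed

lemma coeff_uminus_X_power:
  "coeff ((- [:0, 1 :: 'a :: field:]) ^ n) m = (if m = n then (- 1) ^ n else 0)"
proof -
  have "- [:0, 1 :: 'a:] = smult (- 1) [:0, 1:]"
    by simp
  then have "(- [:0, 1 :: 'a:]) ^ n = monom ((- 1) ^ n) n"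
    by (simp only: smult_power[symmetric] monom_altdef)
  then show ?thesis
    by simp
qed

text \<open>The powers of -t have distinct degrees: a relation over F collects into a polynomial
  relation, \<open>free\<close> makes the three polynomials vanish, and each coefficient of them
  involves a single scalar.\<close>

lemma independent_t_family:
  fixes u v w :: "'a :: field loc sl2"
  assumes free: "\<And>p q r. poly_comb u v w p q r = 0 \<Longrightarrow> p = 0 \<and> q = 0 \<and> r = 0"
  shows "inj (t_family u v w)" and "L_vs.independent (range (t_family u v w))"
proof -
  let ?m = "\<lambda>n. (- [:0, 1 :: 'a:]) ^ n"
  define p where "p i = (case i of A_index n \<Rightarrow> ?m n | _ \<Rightarrow> 0)" for i
  define q where "q i = (case i of B_index n \<Rightarrow> ?m n | _ \<Rightarrow> 0)" for i
  define r where "r i = (case i of psi_Suc_index n \<Rightarrow> ?m n | _ \<Rightarrow> 0)" for i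
  have family: "t_family u v w i = poly_comb u v w (p i) (q i) (r i)" for i
    by (cases i) (simp_all add: p_def q_def r_def poly_comb_def loc_of_poly_simps loc_t_def
        del: minus_pCons)
  have indep: "c j = 0"
    if "finite I" and "(\<Sum>i\<in>I. scale_L (c i) (t_family u v w i)) = 0" and "j \<in> I" for I c j
  proof -
    have "poly_comb u v w (\<Sum>i\<in>I. smult (c i) (p i)) (\<Sum>i\<in>I. smult (c i) (q i))
        (\<Sum>i\<in>I. smult (c i) (r i)) = 0"
      using that(2) by (simp add: family poly_comb_scale poly_comb_sum)
    from free[OF this]
    have zero: "coeff (\<Sum>i\<in>I. smult (c i) (p i)) n = 0" "coeff (\<Sum>i\<in>I. smult (c i) (q i)) n = 0"
      "coeff (\<Sum>i\<in>I. smult (c i) (r i)) n = 0" for n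
      by simp_all
    have coeffs: "coeff (p i) n = (if i = A_index n then (- 1) ^ n else 0)"
      "coeff (q i) n = (if i = B_index n then (- 1) ^ n else 0)"
      "coeff (r i) n = (if i = psi_Suc_index n then (- 1) ^ n else 0)" for i n
      by (cases i; simp add: p_def q_def r_def coeff_uminus_X_power del: minus_pCons)+
    \<comment> \<open>Comparing coefficients in degree \<open>n\<close>, in the polynomial belonging
      to the constructor of \<open>j\<close>, isolates \<open>c j\<close> up to sign.\<close>
    have "(\<Sum>i\<in>I. if i = j then c i * (- 1) ^ n else 0) = 0"
      if "j = A_index n \<or> j = B_index n \<or> j = psi_Suc_index n" for n
      using that zero[of n]
      by (auto simp: coeff_sum coeffs if_distrib[of "\<lambda>x. _ * x"] cong: if_cong)
    then have "c j * (- 1) ^ n = 0"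
      if "j = A_index n \<or> j = B_index n \<or> j = psi_Suc_index n" for n
      using that \<open>finite I\<close> \<open>j \<in> I\<close> by simp
    then show ?thesis
      by (cases j) auto
  qed
  show "inj (t_family u v w)" "L_vs.independent (range (t_family u v w))"
    by (rule independent_family, rule indep, assumption+)+
qed

section \<open>The two bases\<close>

lemma onsager_A_coords: "onsager_A = Sl2 2 0 (- 1)"
  by (simp add: onsager_A_def tensor_def sl2_basis_defs sl2_arith_defs loc_const_hom loc_const_2
      loc_const_uminus)

lemma onsager_B_coords: "onsager_B = Sl2 0 (- 2 * loc_t) (- 1)"
  by (simp add: onsager_B_def tensor_def sl2_basis_defs sl2_arith_defs loc_const_hom loc_const_2
      loc_const_uminus)

text \<open>The third generator is \<open>sl2_y \<otimes> loc_t\<close>: it absorbs one factor -t of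
  the power with exponent i + 1 in \<open>psi_du (Suc i)\<close>.\<close>

lemma basis_0321_eq:
  "basis_0321 = t_family (- onsager_A) onsager_B (Sl2 0 (- 2 * loc_t) (- loc_t))"
proof
  fix i :: basis_index
  show "basis_0321 i = t_family (- onsager_A) onsager_B (Sl2 0 (- 2 * loc_t) (- loc_t)) i"
    by (cases i) (simp_all add: A_du_def B_du_def onsager_A_coords onsager_B_coords tensor_def
        sl2_basis_defs sl2_arith_defs loc_const_hom loc_const_2 loc_const_uminus algebra_simps)
qed

lemma basis_3012_eq: "basis_3012 = t_family onsager_A (- onsager_B) (Sl2 2 0 (- loc_t))"
proof
  fix i :: basis_index
  show "basis_3012 i = t_family onsager_A (- onsager_B) (Sl2 2 0 (- loc_t)) i"
    by (cases i) (simp_all add: A_ud_def B_ud_def onsager_A_coords onsager_B_coords tensor_def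
        sl2_basis_defs sl2_arith_defs loc_const_hom loc_const_2 loc_const_uminus algebra_simps)
qed

section \<open>Freeness of the two generating triples\<close>

lemma free_0321:
  fixes p q r :: "'a :: field_char_0 poly"
  assumes "poly_comb (- onsager_A) onsager_B (Sl2 0 (- 2 * loc_t) (- loc_t)) p q r = 0"
  shows "p = 0 \<and> q = 0 \<and> r = 0"
proof -
  let ?t = "[:0, 1 :: 'a:]"
  let ?c = "poly_comb (- onsager_A) onsager_B (Sl2 0 (- 2 * loc_t) (- loc_t)) p q r"
  \<comment> \<open>All three coordinates are images of polynomials, so injectivity of
    \<open>loc_of_poly\<close> moves the equations to F[t], where 2 and t can be cancelled.\<close>
  have "loc_of_poly (- 2 * p) = coeff_e ?c" "loc_of_poly (- 2 * (?t * (q + r))) = coeff_f ?c"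
    "loc_of_poly (p - q - ?t * r) = coeff_h ?c"
    unfolding loc_of_poly_simps
    by (simp_all add: poly_comb_def onsager_A_coords onsager_B_coords sl2_arith_defs loc_t_def[symmetric]
        algebra_simps)
  then have "loc_of_poly (- 2 * p) = 0" "loc_of_poly (- 2 * (?t * (q + r))) = 0"
    "loc_of_poly (p - q - ?t * r) = 0"
    unfolding assms by (simp_all add: zero_sl2_def)
  then have "p = 0" "q = - r" "p - q - ?t * r = 0"
    unfolding loc_of_poly_eq_0_iff by (simp_all add: eq_neg_iff_add_eq_0 del: mult_pCons_left distrib_left_numeral)
  \<comment> \<open>The first two coordinates leave only \<open>r\<close> in the third, and F[t] is
    a domain.\<close>
  then have "(1 - ?t) * r = 0"
    by (simp add: left_diff_distrib del: mult_pCons_left)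
  then have "r = 0"
    unfolding mult_eq_0_iff by (simp add: one_pCons)
  with \<open>p = 0\<close> \<open>q = - r\<close> show ?thesis by simp
qed

text \<open>As for the other triple, but now the f coordinate kills \<open>q\<close> and the e
  coordinate gives \<open>p = - r\<close>.\<close>

lemma free_3012:
  fixes p q r :: "'a :: field_char_0 poly"
  assumes "poly_comb onsager_A (- onsager_B) (Sl2 2 0 (- loc_t)) p q r = 0"
  shows "p = 0 \<and> q = 0 \<and> r = 0"
proof -
  let ?t = "[:0, 1 :: 'a:]"
  let ?c = "poly_comb onsager_A (- onsager_B) (Sl2 2 0 (- loc_t)) p q r"
  have "loc_of_poly (2 * (p + r)) = coeff_e ?c" "loc_of_poly (2 * (?t * q)) = coeff_f ?c"
    "loc_of_poly (- p + q - ?t * r) = coeff_h ?c"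
    unfolding loc_of_poly_simps
    by (simp_all add: poly_comb_def onsager_A_coords onsager_B_coords sl2_arith_defs loc_t_def[symmetric]
        algebra_simps)
  then have "loc_of_poly (2 * (p + r)) = 0" "loc_of_poly (2 * (?t * q)) = 0"
    "loc_of_poly (- p + q - ?t * r) = 0"
    unfolding assms by (simp_all add: zero_sl2_def)
  then have "p = - r" "q = 0" "- p + q - ?t * r = 0"
    unfolding loc_of_poly_eq_0_iff by (simp_all add: eq_neg_iff_add_eq_0 del: mult_pCons_left distrib_left_numeral)
  then have "(1 - ?t) * r = 0"
    by (simp add: left_diff_distrib del: mult_pCons_left)
  then have "r = 0"
    unfolding mult_eq_0_iff by (simp add: one_pCons)
  with \<open>p = - r\<close> \<open>q = 0\<close> show ?thesis by simp
qed

section \<open>Transition formulas and equality of the spans\<close>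

lemma transition_3012:
  "A_ud i = - A_du i"
  "B_ud i = - B_du i"
  "psi_ud (i + 1) = - A_du i - B_du i + psi_du (i + 1)"
  \<comment> \<open>The third formula is x - z(t-1) = x - (yt + z(t-1)) + yt, multiplied by the i-th
    power of -t.\<close>
  by (simp_all add: A_ud_def A_du_def B_ud_def B_du_def tensor_def sl2_basis_defs sl2_arith_defs
      loc_const_hom loc_const_2 loc_const_uminus algebra_simps)

lemma transition_0321:
  "A_du i = - A_ud i"
  "B_du i = - B_ud i"
  "psi_du (i + 1) = - A_ud i - B_ud i + psi_ud (i + 1)"
  unfolding transition_3012 by simp_all

lemma span_bases_eq:
  "L_vs.span (range (basis_3012 :: _ \<Rightarrow> 'a :: field loc sl2)) = L_vs.span (range basis_0321)"
  unfolding L_vs.span_eq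
proof (intro conjI image_subsetI)
  fix i
  show "basis_3012 i \<in> L_vs.span (range (basis_0321 :: _ \<Rightarrow> 'a loc sl2))"
  proof -
    have "basis_0321 j \<in> L_vs.span (range (basis_0321 :: _ \<Rightarrow> 'a loc sl2))" for j
      by (simp add: L_vs.span_base)
    from this[of "A_index _"] this[of "B_index _"] this[of "psi_Suc_index _"] show ?thesis
      by (cases i) (simp_all add: transition_3012[folded Suc_eq_plus1] L_vs.span_neg L_vs.span_add L_vs.span_diff
          del: psi_du.simps psi_ud.simps)
  qed
  show "basis_0321 i \<in> L_vs.span (range (basis_3012 :: _ \<Rightarrow> 'a loc sl2))"
  proof -
    have "basis_3012 j \<in> L_vs.span (range (basis_3012 :: _ \<Rightarrow> 'a loc sl2))" for j
      by (simp add: L_vs.span_base)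
    from this[of "A_index _"] this[of "B_index _"] this[of "psi_Suc_index _"] show ?thesis
      by (cases i) (simp_all add: transition_0321[folded Suc_eq_plus1] L_vs.span_neg L_vs.span_add L_vs.span_diff
          del: psi_du.simps psi_ud.simps)
  qed
qed

section \<open>The span is the Onsager algebra\<close>

lemma lie_subalgebra_span_0321:
  "lie_subalgebra (L_vs.span (range (basis_0321 :: _ \<Rightarrow> 'a :: field loc sl2)))"
  unfolding lie_subalgebra_def
proof (intro conjI ballI)
  let ?c = "poly_comb (- onsager_A) onsager_B (Sl2 0 (- 2 * loc_t) (- loc_t)) ::
    'a poly \<Rightarrow> 'a poly \<Rightarrow> 'a poly \<Rightarrow> 'a loc sl2"
  \<comment> \<open>The bracket is bilinear over the coefficient ring and alternating, so only the
    brackets of generators enter, weighted by 2x2 minors. The signs of those involving A change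
    because the first generator is -A.\<close>
  have "lie (?c p q r) (?c p' q' r') =
      ?c (2 * (p * q' - q * p') + 2 * [:0, 1:] * (p * r' - r * p'))
         (2 * (p * q' - q * p') - 2 * [:0, 1:] * (q * r' - r * q'))
         (- 4 * (p * q' - q * p') - 2 * (p * r' - r * p') + 2 * (q * r' - r * q'))"
    for p q r p' q' r'
    unfolding poly_comb_def loc_of_poly_simps loc_t_def[symmetric] onsager_A_coords onsager_B_coords
    by (simp add: sl2_arith_defs algebra_simps)
  then show "lie u v \<in> L_vs.span (range basis_0321)"
    if "u \<in> L_vs.span (range basis_0321)" "v \<in> L_vs.span (range basis_0321)" for u v :: "'a loc sl2"
    using that unfolding basis_0321_eq span_t_family by blast
qed simp

text \<open>Multiplication by t must come from brackets: As and Bs give Ys, which in turn gives -tAs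
  and -tBs, so the powers follow by induction.\<close>

lemma basis_0321_in_subalgebra:
  fixes S :: "'a :: field_char_0 loc sl2 set"
  assumes S: "lie_subalgebra S" and A: "onsager_A \<in> S" and B: "onsager_B \<in> S"
  shows "basis_0321 j \<in> S"
proof -
  let ?Y = "Sl2 0 (- 2 * loc_t) (- loc_t) :: 'a loc sl2"
  have sub: "L_vs.subspace S" and lie: "\<And>u v. u \<in> S \<Longrightarrow> v \<in> S \<Longrightarrow> lie u v \<in> S"
    using S by (auto simp: lie_subalgebra_def)
  note closed = L_vs.subspace_add[OF sub] L_vs.subspace_diff[OF sub] L_vs.subspace_neg[OF sub]
    L_vs.subspace_scale[OF sub] lie
  \<comment> \<open>Characteristic zero makes 2 invertible; writing 2u as \<open>u + u\<close> keeps
    to closure under addition.\<close>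
  have half: "scale_L (1 / 2) (u + u) = u" for u :: "'a loc sl2"
    unfolding L_vs.scale_right_distrib L_vs.scale_left_distrib[symmetric] by simp
  have double: "u \<in> S" if "u + u \<in> S" for u
    using closed(4)[OF that, of "1 / 2"] by (simp only: half)
  have Y_step: "?Y \<bullet> s \<in> S" if "onsager_A \<bullet> s \<in> S" "onsager_B \<bullet> s \<in> S" for s
  proof -
    \<comment> \<open>The identity for [A, B], multiplied by s and solved for 4Ys; hence two
      halvings.\<close>
    have "?Y \<bullet> s + ?Y \<bullet> s + (?Y \<bullet> s + ?Y \<bullet> s) = lie (onsager_A \<bullet> s) onsager_B
        - (onsager_A \<bullet> s + onsager_A \<bullet> s) + (onsager_B \<bullet> s + onsager_B \<bullet> s)"
      by (simp add: onsager_A_coords onsager_B_coords sl2_arith_defs algebra_simps)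
    also have "\<dots> \<in> S"
      by (intro closed that B)
    finally show ?thesis
      by (rule double[OF double])
  qed
  have A_step: "onsager_A \<bullet> (- loc_t * s) \<in> S" if "?Y \<bullet> s \<in> S" for s
  proof -
    have "onsager_A \<bullet> (- loc_t * s) + onsager_A \<bullet> (- loc_t * s) =
        ?Y \<bullet> s + ?Y \<bullet> s - lie onsager_A (?Y \<bullet> s)"
      by (simp add: onsager_A_coords sl2_arith_defs algebra_simps)
    also have "\<dots> \<in> S"
      by (intro closed that A)
    finally show ?thesis
      by (rule double)
  qed
  have B_step: "onsager_B \<bullet> (- loc_t * s) \<in> S" if "?Y \<bullet> s \<in> S" for s
  proof -
    have "onsager_B \<bullet> (- loc_t * s) + onsager_B \<bullet> (- loc_t * s) =
        lie onsager_B (?Y \<bullet> s) - (?Y \<bullet> s + ?Y \<bullet> s)"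
      by (simp add: onsager_B_coords sl2_arith_defs algebra_simps)
    also have "\<dots> \<in> S"
      by (intro closed that B)
    finally show ?thesis
      by (rule double)
  qed
  have powers: "onsager_A \<bullet> (- loc_t) ^ i \<in> S \<and> onsager_B \<bullet> (- loc_t) ^ i \<in> S" for i
  proof (induction i)
    case 0
    show ?case using A B by simp
  next
    case (Suc i)
    then have "?Y \<bullet> (- loc_t) ^ i \<in> S"
      by (intro Y_step) simp_all
    then show ?case
      using A_step B_step by simp
  qed
  show ?thesis
    unfolding basis_0321_eq
    by (cases j) (use powers Y_step closed(3) in \<open>simp_all add: sl2_mod.scale_minus_left\<close>)
qed

text \<open>The hull is the least subalgebra containing A and B: every such subalgebra contains the
  family, and the span is itself one.\<close>

lemma span_0321: "L_vs.span (range basis_0321) = (onsager :: 'a :: field_char_0 loc sl2 set)"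
proof
  show "L_vs.span (range basis_0321) \<subseteq> (onsager :: 'a loc sl2 set)"
    unfolding onsager_def hull_def
  proof (intro Inter_greatest L_vs.span_minimal image_subsetI)
    fix S :: "'a loc sl2 set" and j
    assume "S \<in> {S. lie_subalgebra S \<and> {onsager_A, onsager_B} \<subseteq> S}"
    then have "lie_subalgebra S" "onsager_A \<in> S" "onsager_B \<in> S"
      by simp_all
    then show "basis_0321 j \<in> S" "L_vs.subspace S"
      by (rule basis_0321_in_subalgebra, simp only: lie_subalgebra_def)
  qed
  have "basis_0321 j \<in> L_vs.span (range (basis_0321 :: _ \<Rightarrow> 'a loc sl2))" for j
    by (simp add: L_vs.span_base)
  \<comment> \<open>At index 0 the family gives -A and B, hence the negation.\<close>
  from L_vs.span_neg[OF this[of "A_index 0"]] this[of "B_index 0"]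
  have "{onsager_A, onsager_B} \<subseteq> L_vs.span (range (basis_0321 :: _ \<Rightarrow> 'a loc sl2))"
    unfolding basis_0321_eq by simp
  then show "(onsager :: 'a loc sl2 set) \<subseteq> L_vs.span (range basis_0321)"
    unfolding onsager_def by (rule hull_minimal[where S = lie_subalgebra]) (rule lie_subalgebra_span_0321)
qed

theorem lemma11p2:
  shows "is_basis_of (basis_0321 :: basis_index \<Rightarrow> 'a :: field_char_0 loc sl2) onsager \<and>
    is_basis_of (basis_3012 :: basis_index \<Rightarrow> 'a loc sl2) onsager \<and>
    (\<forall>i. (A_ud i :: 'a loc sl2) = - A_du i \<and>
         (B_ud i :: 'a loc sl2) = - B_du i \<and>
         (psi_ud (i + 1) :: 'a loc sl2) = - A_du i - B_du i + psi_du (i + 1)) \<and>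
    (\<forall>i. (A_du i :: 'a loc sl2) = - A_ud i \<and>
         (B_du i :: 'a loc sl2) = - B_ud i \<and>
         (psi_du (i + 1) :: 'a loc sl2) = - A_ud i - B_ud i + psi_ud (i + 1))"
proof (intro conjI allI)
  show "is_basis_of (basis_0321 :: basis_index \<Rightarrow> 'a loc sl2) onsager"
    unfolding is_basis_of_def span_0321
    unfolding basis_0321_eq
    by (intro conjI refl; rule independent_t_family; rule free_0321)
  show "is_basis_of (basis_3012 :: basis_index \<Rightarrow> 'a loc sl2) onsager"
    \<comment> \<open>Equality of the spans transfers the generating property from the first family;
      freeness gives the rest.\<close>
    unfolding is_basis_of_def span_bases_eq span_0321
    unfolding basis_3012_eq
    by (intro conjI refl; rule independent_t_family; rule free_3012)
qed (fact transition_3012 transition_0321)+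

end
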